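(* For every integer $r\ge 1$, the odd independence density $\varrho_{\mathrm{od}}$ of the infinite $r$-Bishop graph satisfies $$\frac{1}{2r+1}\ \le\ \varrho_{\mathrm{od}}\ \le\ \frac{3}{4r+3}.$$
   Context: The infinite $r$-Bishop graph has vertex set $\mathbb{Z}^2$; two distinct vertices $(a,b),(a',b')$ are adjacent iff ($a-a'=b-b'$ or $a-a'=b'-b$) and $|a-a'|\le r$. $N(v)$ is the open neighborhood of $v$. An odd independent set is an independent set $S$ of vertices such that every vertex $v\notin S$ has either $N(v)\cap S=\varnothing$ or $|N(v)\cap S|$ odd. The odd independence density is $\varrho_{\mathrm{od}}:=\sup_S\limsup_{H_n,\ n\to\infty}|S\cap V(H_n)|/|V(H_n)|$, where $S$ ranges over all odd independent sets of the graph and $H_n$ ranges over all subgraphs induced by the vertices in axis-parallel $n\times n$ squares of $\mathbb{Z}^2$. *)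

theory Defs
  imports Complex_Main "HOL-Library.Extended_Real"
begin

text \<open>A graph on \<open>\<int> \<times> \<int>\<close> is given by its adjacency relation; its vertex set is the whole type.\<close>

definition bishop_adj :: "nat \<Rightarrow> int \<times> int \<Rightarrow> int \<times> int \<Rightarrow> bool" where
  "bishop_adj r u v \<longleftrightarrow>
     u \<noteq> v \<and>
     (fst u - fst v = snd u - snd v \<or> fst u - fst v = snd v - snd u) \<and>
     \<bar>fst u - fst v\<bar> \<le> int r"

definition neighborhood :: "('v \<Rightarrow> 'v \<Rightarrow> bool) \<Rightarrow> 'v \<Rightarrow> 'v set" where
  "neighborhood adj v = {w. adj v w}"

definition independent_set :: "('v \<Rightarrow> 'v \<Rightarrow> bool) \<Rightarrow> 'v set \<Rightarrow> bool" where
  "independent_set adj S \<longleftrightarrow> (\<forall>u\<in>S. \<forall>v\<in>S. \<not> adj u v)"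

text \<open>For infinite sets \<^const>\<open>card\<close> is 0, hence even, so \<open>odd (card A)\<close> also says that \<open>A\<close> is finite.\<close>

definition odd_independent_set :: "('v \<Rightarrow> 'v \<Rightarrow> bool) \<Rightarrow> 'v set \<Rightarrow> bool" where
  "odd_independent_set adj S \<longleftrightarrow>
     independent_set adj S \<and>
     (\<forall>v. v \<notin> S \<longrightarrow>
        neighborhood adj v \<inter> S = {} \<or> odd (card (neighborhood adj v \<inter> S)))"

definition squares :: "nat \<Rightarrow> (int \<times> int) set set" where
  "squares n = {{a..<a + int n} \<times> {b..<b + int n} | a b. True}"

text \<open>
  The limit superior runs over all squares of side \<open>n\<close>, in any position, as \<open>n\<close> tends to
  infinity; this is the \<open>limsup\<close> over \<open>n\<close> of the supremum over the squares of side \<open>n\<close>.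
  Extended reals make all suprema total.
\<close>

definition upper_density :: "(int \<times> int) set \<Rightarrow> ereal" where
  "upper_density S =
     limsup (\<lambda>n. SUP Q\<in>squares n. ereal (real (card (S \<inter> Q)) / real (card Q)))"

definition odd_independence_density :: "(int \<times> int \<Rightarrow> int \<times> int \<Rightarrow> bool) \<Rightarrow> ereal" where
  "odd_independence_density adj = (SUP S\<in>{S. odd_independent_set adj S}. upper_density S)"

end

theory Submission
  imports Defs "HOL-Real_Asymp.Real_Asymp"
begin

text \<open>
  Every vertex has \<open>4r\<close> neighbours, and they lie on four diagonal rays, each of which is a clique.
  An independent set thus meets a neighbourhood in at most four vertices, and an odd independent
  set \<open>S\<close> meets the neighbourhood of a vertex outside \<open>S\<close> in at most three. Counting the edges
  between the points of \<open>S\<close> in a square \<open>Q\<close> of side \<open>n\<close> and the vertices outside \<open>S\<close> in the square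
  of side \<open>n + 2r\<close> around \<open>Q\<close> gives
  \<open>4r |S \<inter> Q| \<le> 3 ((n + 2r)\<^sup>2 - |S \<inter> Q|)\<close>, whence the upper bound.

  For the lower bound, let \<open>p = \<lfloor>(a + b) / 2\<rfloor>\<close> and \<open>q = \<lfloor>(a - b) / 2\<rfloor>\<close>. The neighbours of a vertex
  change exactly one of \<open>p\<close>, \<open>q\<close>, by at most \<open>r\<close>. Let \<open>S\<close> consist of the \<open>(a, b)\<close> with
  \<open>p mod (r + 1) = q mod (2r + 1)\<close>. Along an antidiagonal, where \<open>p\<close> is
  constant, \<open>S\<close> contains every \<open>(2r + 1)\<close>-th vertex, so a vertex outside \<open>S\<close> has exactly one neighbour
  in \<open>S\<close> there. Along a diagonal, where \<open>q\<close> is constant, \<open>S\<close> contains no vertex or every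
  \<open>(r + 1)\<close>-th one, so a vertex outside \<open>S\<close> has no or two neighbours in \<open>S\<close> there.
  Finally \<open>2r + 1\<close> translates of \<open>S\<close> along the antidiagonal partition the plane, so among the
  corresponding translates of any square one has at least the proportion \<open>1 / (2r + 1)\<close> of its
  points in \<open>S\<close>.
\<close>

section \<open>Neighbourhoods in the Bishop graph\<close>

lemma bishop_adj_sym: "bishop_adj r u v \<Longrightarrow> bishop_adj r v u"
  unfolding bishop_adj_def by auto

lemma bishop_neighborhood:
  "neighborhood (bishop_adj r) (a, b) =
     (\<lambda>k. (a + k, b + k)) ` ({- int r..int r} - {0}) \<union>
     (\<lambda>k. (a + k, b - k)) ` ({- int r..int r} - {0})" (is "?L = ?R")
proof (intro equalityI subsetI)
  fix w assume "w \<in> ?L"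
  then obtain c d where w: "w = (c, d)" and "(a, b) \<noteq> (c, d)"
    and "a - c = b - d \<or> a - c = d - b" and "\<bar>a - c\<bar> \<le> int r"
    by (cases w) (auto simp: neighborhood_def bishop_adj_def)
  then have "c - a \<in> {- int r..int r} - {0}" and "d = b + (c - a) \<or> d = b - (c - a)"
    by auto
  then show "w \<in> ?R"
    unfolding w by (auto intro!: image_eqI[where x = "c - a"])
next
  fix w assume "w \<in> ?R"
  then show "w \<in> ?L" by (auto simp: neighborhood_def bishop_adj_def)
qed

lemma card_bishop_neighborhood_Int:
  "card (neighborhood (bishop_adj r) (a, b) \<inter> S) =
     card {k \<in> {- int r..int r} - {0}. (a + k, b + k) \<in> S} +
     card {k \<in> {- int r..int r} - {0}. (a + k, b - k) \<in> S}"
proof -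
  let ?A = "{k \<in> {- int r..int r} - {0}. (a + k, b + k) \<in> S}"
  let ?B = "{k \<in> {- int r..int r} - {0}. (a + k, b - k) \<in> S}"
  have "neighborhood (bishop_adj r) (a, b) \<inter> S =
      (\<lambda>k. (a + k, b + k)) ` ?A \<union> (\<lambda>k. (a + k, b - k)) ` ?B"
    unfolding bishop_neighborhood by auto
  moreover have "card ((\<lambda>k. (a + k, b + k)) ` ?A \<union> (\<lambda>k. (a + k, b - k)) ` ?B) =
      card ((\<lambda>k. (a + k, b + k)) ` ?A) + card ((\<lambda>k. (a + k, b - k)) ` ?B)"
  proof (rule card_Un_disjoint)
    show "finite ((\<lambda>k. (a + k, b + k)) ` ?A)" "finite ((\<lambda>k. (a + k, b - k)) ` ?B)"
      by (rule finite_imageI, rule finite_subset[of _ "{- int r..int r}"], blast, simp)+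
    show "(\<lambda>k. (a + k, b + k)) ` ?A \<inter> (\<lambda>k. (a + k, b - k)) ` ?B = {}"
      by auto
  qed
  ultimately show ?thesis
    by (simp add: card_image inj_on_def)
qed

lemma finite_bishop_neighborhood: "finite (neighborhood (bishop_adj r) v)"
  by (cases v) (simp add: bishop_neighborhood)

lemma card_bishop_neighborhood: "card (neighborhood (bishop_adj r) v) = 4 * r"
proof -
  obtain a b where v: "v = (a, b)" by (cases v)
  have "card ({- int r..int r} - {0}) = 2 * r"
    by (subst card_Diff_subset) auto
  moreover have "{k. k \<in> {- int r..int r} - {0}} = {- int r..int r} - {0}" by blast
  ultimately show ?thesis
    using card_bishop_neighborhood_Int[of r a b UNIV] unfolding v by simp
qed

lemma card_bishop_neighborhood_independent_le_4:
  assumes "independent_set (bishop_adj r) S"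
  shows "card (neighborhood (bishop_adj r) v \<inter> S) \<le> 4"
proof -
  obtain a b where v: "v = (a, b)" by (cases v)
  let ?N = "neighborhood (bishop_adj r) v \<inter> S"
  let ?ray = "\<lambda>w :: int \<times> int. (sgn (fst w - a), sgn (snd w - b))"
  \<comment> \<open>The signs of the coordinate differences tell on which of the four rays a neighbour lies.\<close>
  have "?ray ` ?N \<subseteq> {-1, 1} \<times> {-1, 1}"
  proof (rule image_subsetI)
    fix w assume "w \<in> ?N"
    then have "fst w \<noteq> a" "snd w \<noteq> b"
      by (auto simp: v neighborhood_def bishop_adj_def prod_eq_iff)
    then show "?ray w \<in> {-1, 1} \<times> {-1, 1}" by (simp add: sgn_if)
  qed
  moreover have "inj_on ?ray ?N"
  proof (rule inj_onI, rule ccontr)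
    fix w z assume w: "w \<in> ?N" and z: "z \<in> ?N" and eq: "?ray w = ?ray z" and "w \<noteq> z"
    obtain w1 w2 z1 z2 where wz: "w = (w1, w2)" "z = (z1, z2)" by (cases w, cases z)
    have "bishop_adj r w z"
      using w z eq \<open>w \<noteq> z\<close> unfolding wz v neighborhood_def bishop_adj_def
      by (auto simp: sgn_if split: if_splits)
    with w z assms show False by (auto simp: independent_set_def)
  qed
  ultimately have "card ?N \<le> card ({-1, 1 :: int} \<times> {-1, 1 :: int})"
    by (intro card_inj_on_le[where f = ?ray]) auto
  then show ?thesis by (simp add: card_cartesian_product)
qed

lemma card_bishop_neighborhood_odd_independent_le_3:
  assumes "odd_independent_set (bishop_adj r) S" and "v \<notin> S"
  shows "card (neighborhood (bishop_adj r) v \<inter> S) \<le> 3"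
proof -
  let ?N = "neighborhood (bishop_adj r) v \<inter> S"
  have "card ?N \<le> 4"
    using assms(1) card_bishop_neighborhood_independent_le_4
    by (auto simp: odd_independent_set_def)
  moreover have "?N = {} \<or> odd (card ?N)"
    using assms unfolding odd_independent_set_def by blast
  then have "card ?N \<noteq> 4" by auto
  ultimately show ?thesis by linarith
qed

section \<open>The upper bound\<close>

lemma odd_independent_set_card_square:
  assumes S: "odd_independent_set (bishop_adj r) S" and Q: "Q \<in> squares n"
  shows "(4 * r + 3) * card (S \<inter> Q) \<le> 3 * (n + 2 * r)\<^sup>2"
proof -
  obtain a b where Q: "Q = {a..<a + int n} \<times> {b..<b + int n}"
    using Q by (auto simp: squares_def)
  define Q' where "Q' = {a - int r..<a + int n + int r} \<times> {b - int r..<b + int n + int r}"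
  let ?N = "neighborhood (bishop_adj r)"
  have "nat (int n + 2 * int r) = n + 2 * r" by simp
  then have cQ': "card Q' = (n + 2 * r)\<^sup>2"
    by (simp add: Q'_def card_cartesian_product power2_eq_square algebra_simps)
  have fin: "finite Q" "finite Q'" by (auto simp: Q Q'_def)
  have sub: "Q \<subseteq> Q'" by (auto simp: Q Q'_def)
  have "4 * r * card (S \<inter> Q) = card (Sigma (S \<inter> Q) ?N)"
    using fin by (simp add: card_bishop_neighborhood finite_bishop_neighborhood card_SigmaI)
  also have "\<dots> = card (prod.swap ` Sigma (S \<inter> Q) ?N)"
    by (rule card_image[symmetric]) (auto simp: inj_on_def)
  also have "\<dots> \<le> card (Sigma (Q' - S) (\<lambda>v. ?N v \<inter> S))"
  proof (rule card_mono)
    show "finite (Sigma (Q' - S) (\<lambda>v. ?N v \<inter> S))"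
      using fin by (auto intro!: finite_SigmaI simp: finite_bishop_neighborhood)
    show "prod.swap ` Sigma (S \<inter> Q) ?N \<subseteq> Sigma (Q' - S) (\<lambda>v. ?N v \<inter> S)"
    proof clarsimp
      fix x1 x2 v1 v2
      assume s: "(x1, x2) \<in> S" "(x1, x2) \<in> Q" and "(v1, v2) \<in> ?N (x1, x2)"
      then have adj: "bishop_adj r (x1, x2) (v1, v2)" by (simp add: neighborhood_def)
      have "(v1, v2) \<notin> S"
        using S s adj by (auto simp: odd_independent_set_def independent_set_def)
      moreover have "(v1, v2) \<in> Q'"
        using s adj by (auto simp: Q Q'_def bishop_adj_def)
      moreover have "(x1, x2) \<in> ?N (v1, v2)"
        using bishop_adj_sym[OF adj] by (simp add: neighborhood_def)
      ultimately show "(v1, v2) \<in> Q' \<and> (v1, v2) \<notin> S \<and> (x1, x2) \<in> ?N (v1, v2)" by blast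
    qed
  qed
  also have "\<dots> = (\<Sum>v\<in>Q' - S. card (?N v \<inter> S))"
    using fin by (simp add: card_SigmaI finite_bishop_neighborhood)
  also have "\<dots> \<le> (\<Sum>v\<in>Q' - S. 3)"
    by (intro sum_mono card_bishop_neighborhood_odd_independent_le_3[OF S]) auto
  also have "\<dots> = 3 * card (Q' - S)" by simp
  finally have edges: "4 * r * card (S \<inter> Q) \<le> 3 * card (Q' - S)" .
  have "card (S \<inter> Q) + card (Q' - S) = card ((S \<inter> Q) \<union> (Q' - S))"
    using fin by (subst card_Un_disjoint) auto
  also have "\<dots> \<le> card Q'"
    using fin sub by (intro card_mono) auto
  finally have "card (S \<inter> Q) + card (Q' - S) \<le> (n + 2 * r)\<^sup>2"
    unfolding cQ' .
  with edges show ?thesis by (simp add: algebra_simps)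
qed

lemma card_square: "Q \<in> squares n \<Longrightarrow> card Q = n\<^sup>2"
  by (auto simp: squares_def card_cartesian_product power2_eq_square)

lemma upper_density_odd_independent_set_le:
  assumes "odd_independent_set (bishop_adj r) S"
  shows "upper_density S \<le> ereal (3 / (4 * real r + 3))"
proof -
  let ?f = "\<lambda>n. 3 / (4 * real r + 3) * ((real n + 2 * real r) / real n)\<^sup>2"
  have bound: "(SUP Q\<in>squares n. ereal (real (card (S \<inter> Q)) / real (card Q))) \<le> ereal (?f n)"
    if "n \<ge> 1" for n
  proof (rule SUP_least)
    fix Q assume Q: "Q \<in> squares n"
    have "real ((4 * r + 3) * card (S \<inter> Q)) \<le> real (3 * (n + 2 * r)\<^sup>2)"
      using odd_independent_set_card_square[OF assms Q] by (simp only: of_nat_le_iff)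
    then have "real (card (S \<inter> Q)) \<le> 3 / (4 * real r + 3) * (real n + 2 * real r)\<^sup>2"
      by (simp add: field_simps)
    then have "real (card (S \<inter> Q)) / (real n)\<^sup>2
        \<le> 3 / (4 * real r + 3) * (real n + 2 * real r)\<^sup>2 / (real n)\<^sup>2"
      by (rule divide_right_mono) simp
    then show "ereal (real (card (S \<inter> Q)) / real (card Q)) \<le> ereal (?f n)"
      by (simp add: card_square[OF Q] power_divide)
  qed
  have "(\<lambda>n. ((real n + 2 * real r) / real n)\<^sup>2) \<longlonglongrightarrow> 1"
    by real_asymp
  from tendsto_mult[OF tendsto_const this] have "?f \<longlonglongrightarrow> 3 / (4 * real r + 3) * 1" .
  then have lim: "limsup (\<lambda>n. ereal (?f n)) = ereal (3 / (4 * real r + 3))"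
    by (intro lim_imp_Limsup) simp_all
  have "upper_density S \<le> limsup (\<lambda>n. ereal (?f n))"
    unfolding upper_density_def
    by (intro Limsup_mono eventually_sequentiallyI[of 1] bound)
  with lim show ?thesis by simp
qed

section \<open>The lower bound\<close>

text \<open>
  An odd independent set of density \<open>1 / (2r + 1)\<close>. The integer divisions by two round down, so that
  the one formula serves both components of the graph (\<open>a + b\<close> even, \<open>a + b\<close> odd).
\<close>

definition bishop_pattern :: "nat \<Rightarrow> (int \<times> int) set" where
  "bishop_pattern r =
     {(a, b). ((a + b) div 2) mod (int r + 1) = ((a - b) div 2) mod (2 * int r + 1)}"

lemma bishop_pattern_diagonal:
  "(a + k, b + k) \<in> bishop_pattern r \<longleftrightarrow>
     ((a + b) div 2 + k) mod (int r + 1) = ((a - b) div 2) mod (2 * int r + 1)"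
proof -
  have "(a + k + (b + k)) div 2 = (a + b) div 2 + k" by presburger
  then show ?thesis by (simp add: bishop_pattern_def add.commute)
qed

lemma bishop_pattern_antidiagonal:
  "(a + k, b - k) \<in> bishop_pattern r \<longleftrightarrow>
     ((a + b) div 2) mod (int r + 1) = ((a - b) div 2 + k) mod (2 * int r + 1)"
proof -
  have "(a + k - (b - k)) div 2 = (a - b) div 2 + k" by presburger
  then show ?thesis by (simp add: bishop_pattern_def add.commute)
qed

text \<open>Every interval of \<open>m\<close> consecutive integers represents each residue modulo \<open>m\<close> exactly once.\<close>

lemma ex1_mod_eq_in_interval:
  fixes l m q t :: int
  assumes "0 \<le> t" "t < m"
  shows "\<exists>!k. k \<in> {l..<l + m} \<and> (q + k) mod m = t"
proof (rule ex1I)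
  let ?k = "l + (t - q - l) mod m"
  have "(q + ?k) mod m = (q + l + (t - q - l)) mod m"
    by (metis add.assoc mod_add_right_eq)
  then show "?k \<in> {l..<l + m} \<and> (q + ?k) mod m = t"
    using assms by simp
next
  fix k assume k: "k \<in> {l..<l + m} \<and> (q + k) mod m = t"
  then have "(t - q - l) mod m = (q + k - q - l) mod m"
    by (metis mod_diff_left_eq)
  also have "\<dots> = k - l" using k by simp
  finally show "k = l + (t - q - l) mod m" by simp
qed

lemma bishop_pattern_antidiagonal_ex1:
  "\<exists>!k. k \<in> {l..<l + (2 * int r + 1)} \<and> (a + k, b - k) \<in> bishop_pattern r"
proof -
  let ?t = "((a + b) div 2) mod (int r + 1)"
  have "0 \<le> ?t" "?t < int r + 1" by (rule pos_mod_sign pos_mod_bound, simp)+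
  then have "\<exists>!k. k \<in> {l..<l + (2 * int r + 1)} \<and> ((a - b) div 2 + k) mod (2 * int r + 1) = ?t"
    by (intro ex1_mod_eq_in_interval) linarith+
  then show ?thesis unfolding bishop_pattern_antidiagonal by (simp only: eq_commute)
qed

lemma card_bishop_pattern_antidiagonal:
  assumes "(a, b) \<notin> bishop_pattern r"
  shows "card {k \<in> {- int r..int r} - {0}. (a + k, b - k) \<in> bishop_pattern r} = 1"
proof -
  have "{- int r..< - int r + (2 * int r + 1)} = {- int r..int r}" by auto
  with bishop_pattern_antidiagonal_ex1[of "- int r" r a b]
  have "\<exists>!k. k \<in> {- int r..int r} \<and> (a + k, b - k) \<in> bishop_pattern r" by simp
  then obtain k where "{k \<in> {- int r..int r}. (a + k, b - k) \<in> bishop_pattern r} = {k}"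
    by blast
  moreover have "{k \<in> {- int r..int r} - {0}. (a + k, b - k) \<in> bishop_pattern r} =
      {k \<in> {- int r..int r}. (a + k, b - k) \<in> bishop_pattern r}"
    using assms by auto
  ultimately show ?thesis by simp
qed

lemma card_bishop_pattern_diagonal:
  assumes "(a, b) \<notin> bishop_pattern r"
  shows "card {k \<in> {- int r..int r} - {0}. (a + k, b + k) \<in> bishop_pattern r} \<in> {0, 2}"
proof -
  let ?p = "(a + b) div 2" and ?c = "((a - b) div 2) mod (2 * int r + 1)"
  let ?K = "{k \<in> {- int r..int r} - {0}. (a + k, b + k) \<in> bishop_pattern r}"
  have "0 \<le> ?c" by simp
  show ?thesis
  proof (cases "?c < int r + 1")
    case False
    have "(?p + k) mod (int r + 1) < int r + 1" for k by (rule pos_mod_bound) simp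
    with False have "?K = {}" unfolding bishop_pattern_diagonal
      by (metis (mono_tags, lifting) empty_Collect_eq)
    then show ?thesis by (simp only: card.empty insertI1)
  next
    case True
    \<comment> \<open>Both \<open>{1..r + 1}\<close> and \<open>{- r..0}\<close> contain one solution, and their elements \<open>r + 1\<close> and \<open>0\<close> are
        not solutions because the vertex itself is outside the pattern.\<close>
    obtain i where i: "{k. k \<in> {1..<1 + (int r + 1)} \<and> (?p + k) mod (int r + 1) = ?c} = {i}"
      using ex1_mod_eq_in_interval[OF \<open>0 \<le> ?c\<close> True, of 1 ?p] by blast
    obtain j where j: "{k. k \<in> {- int r..< - int r + (int r + 1)} \<and>
        (?p + k) mod (int r + 1) = ?c} = {j}"
      using ex1_mod_eq_in_interval[OF \<open>0 \<le> ?c\<close> True, of "- int r" ?p] by blast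
    have nz: "?p mod (int r + 1) \<noteq> ?c"
      using assms bishop_pattern_diagonal[of a 0 b r] by simp
    have i': "i \<in> {1..<1 + (int r + 1)}" "(?p + i) mod (int r + 1) = ?c" using i by blast+
    have j': "j \<in> {- int r..< - int r + (int r + 1)}" "(?p + j) mod (int r + 1) = ?c"
      using j by blast+
    have "i \<noteq> int r + 1" "j \<noteq> 0" using i'(2) j'(2) nz by auto
    then have ij: "1 \<le> i" "i \<le> int r" "- int r \<le> j" "j < 0" using i'(1) j'(1) by auto
    have "?K = {i, j}"
    proof (intro equalityI subsetI)
      fix k assume "k \<in> ?K"
      then have k: "- int r \<le> k" "k \<le> int r" "k \<noteq> 0" "(?p + k) mod (int r + 1) = ?c"
        unfolding bishop_pattern_diagonal by auto
      show "k \<in> {i, j}"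
      proof (cases "k > 0")
        case True
        with k have "k \<in> {i}" unfolding i[symmetric] by simp
        then show ?thesis by simp
      next
        case False
        with k have "k \<in> {j}" unfolding j[symmetric] by simp
        then show ?thesis by simp
      qed
    next
      fix k assume "k \<in> {i, j}"
      then show "k \<in> ?K" unfolding bishop_pattern_diagonal using ij i'(2) j'(2) by auto
    qed
    then show ?thesis using ij by simp
  qed
qed

lemma bishop_pattern_independent: "independent_set (bishop_adj r) (bishop_pattern r)"
  unfolding independent_set_def
proof (intro ballI notI)
  fix u v assume u: "u \<in> bishop_pattern r" and v: "v \<in> bishop_pattern r"
    and "bishop_adj r u v"
  obtain a b where ab: "u = (a, b)" by (cases u)
  have "v \<in> neighborhood (bishop_adj r) (a, b)"
    using \<open>bishop_adj r u v\<close> by (simp add: ab neighborhood_def)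
  then obtain k where k: "- int r \<le> k" "k \<le> int r" "k \<noteq> 0"
    and "v = (a + k, b + k) \<or> v = (a + k, b - k)"
    unfolding bishop_neighborhood by fastforce
  then consider "v = (a + k, b + k)" | "v = (a + k, b - k)" by blast
  then show False
  proof cases
    case 1
    have "((a + b) div 2 + k) mod (int r + 1) = ((a + b) div 2 + 0) mod (int r + 1)"
      using u v bishop_pattern_diagonal[of a k b r] bishop_pattern_diagonal[of a 0 b r]
      by (simp add: ab 1)
    then have "(int r + 1) dvd k" by (simp add: mod_eq_dvd_iff)
    then show False using k zdvd_imp_le[of "int r + 1" "\<bar>k\<bar>"] by auto
  next
    case 2
    have "((a - b) div 2 + k) mod (2 * int r + 1) = ((a - b) div 2 + 0) mod (2 * int r + 1)"
      using u v bishop_pattern_antidiagonal[of a k b r] bishop_pattern_antidiagonal[of a 0 b r]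
      by (simp add: ab 2)
    then have "(2 * int r + 1) dvd k" by (simp add: mod_eq_dvd_iff)
    then show False using k zdvd_imp_le[of "2 * int r + 1" "\<bar>k\<bar>"] by auto
  qed
qed

lemma bishop_pattern_odd_independent: "odd_independent_set (bishop_adj r) (bishop_pattern r)"
  unfolding odd_independent_set_def
proof (intro conjI allI impI bishop_pattern_independent disjI2)
  fix v assume v: "v \<notin> bishop_pattern r"
  obtain a b where ab: "v = (a, b)" by (cases v)
  show "odd (card (neighborhood (bishop_adj r) v \<inter> bishop_pattern r))"
    using card_bishop_pattern_antidiagonal[of a b r] card_bishop_pattern_diagonal[of a b r] v
    by (auto simp: ab card_bishop_neighborhood_Int)
qed

text \<open>
  Sliding a square \<open>Q\<close> over \<open>2r + 1\<close> consecutive positions along the antidiagonal moves each of its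
  points into the pattern exactly once, so on average a \<open>1 / (2r + 1)\<close> part of \<open>Q\<close> is covered.
\<close>

lemma bishop_pattern_dense_square:
  "\<exists>Q\<in>squares n. n\<^sup>2 \<le> (2 * r + 1) * card (bishop_pattern r \<inter> Q)"
proof (rule ccontr)
  assume "\<not> ?thesis"
  then have less: "(2 * r + 1) * card (bishop_pattern r \<inter> Q) < n\<^sup>2" if "Q \<in> squares n" for Q
    using that by (meson not_le)
  define I where "I = {0..<2 * int r + 1}"
  define P where "P = {0..<int n} \<times> {0..<int n}"
  define Q where "Q k = {k..<k + int n} \<times> {- k..< - k + int n}" for k
  define C where "C k = {v \<in> P. (fst v + k, snd v - k) \<in> bishop_pattern r}" for k
  have Q: "Q k \<in> squares n" for k unfolding squares_def Q_def by blast
  have card_C: "card (C k) = card (bishop_pattern r \<inter> Q k)" for k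
  proof (rule bij_betw_same_card)
    show "bij_betw (\<lambda>v. (fst v + k, snd v - k)) (C k) (bishop_pattern r \<inter> Q k)"
      by (rule bij_betw_byWitness[where f' = "\<lambda>v. (fst v - k, snd v + k)"])
        (auto simp: C_def P_def Q_def)
  qed
  have fin: "finite P" "finite I" by (auto simp: P_def I_def)
  have "n\<^sup>2 = card P" by (simp add: P_def card_cartesian_product power2_eq_square)
  also have "\<dots> = card (\<Union>k\<in>I. C k)"
  proof (rule arg_cong[where f = card])
    have "v \<in> (\<Union>k\<in>I. C k)" if "v \<in> P" for v
      using that bishop_pattern_antidiagonal_ex1[of 0 r "fst v" "snd v"]
      by (auto simp: I_def C_def)
    then show "P = (\<Union>k\<in>I. C k)" by (auto simp: C_def)
  qed
  also have "\<dots> \<le> (\<Sum>k\<in>I. card (C k))"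
    using fin(2) by (rule card_UN_le)
  finally have "(2 * r + 1) * n\<^sup>2 \<le> (\<Sum>k\<in>I. (2 * r + 1) * card (C k))"
    unfolding sum_distrib_left[symmetric] by (rule mult_left_mono) simp
  also have "\<dots> < (\<Sum>k\<in>I. n\<^sup>2)"
    using fin(2) less[OF Q] by (intro sum_strict_mono) (auto simp: card_C I_def)
  also have "\<dots> = (2 * r + 1) * n\<^sup>2"
    by (simp add: I_def nat_add_distrib nat_mult_distrib)
  finally show False by simp
qed

lemma upper_density_bishop_pattern_ge:
  "ereal (1 / (2 * real r + 1)) \<le> upper_density (bishop_pattern r)"
proof -
  let ?d = "\<lambda>n. SUP Q\<in>squares n. ereal (real (card (bishop_pattern r \<inter> Q)) / real (card Q))"
  have bound: "ereal (1 / (2 * real r + 1)) \<le> ?d n" if "n \<ge> 1" for n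
  proof -
    obtain Q where Q: "Q \<in> squares n" and le: "n\<^sup>2 \<le> (2 * r + 1) * card (bishop_pattern r \<inter> Q)"
      using bishop_pattern_dense_square by blast
    have "real (n\<^sup>2) \<le> real ((2 * r + 1) * card (bishop_pattern r \<inter> Q))"
      using le by (simp only: of_nat_le_iff)
    then have "1 / (2 * real r + 1) \<le> real (card (bishop_pattern r \<inter> Q)) / real (card Q)"
      using that by (simp add: card_square[OF Q] field_simps)
    then show ?thesis by (intro SUP_upper2[OF Q]) simp
  qed
  have "limsup (\<lambda>n. ereal (1 / (2 * real r + 1))) \<le> limsup ?d"
    by (intro Limsup_mono eventually_sequentiallyI[of 1] bound)
  then show ?thesis by (simp add: upper_density_def Limsup_const)
qed

theorem theorem21:
  fixes r :: nat
  assumes "r \<ge> 1"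
  shows "ereal (1 / (2 * real r + 1)) \<le> odd_independence_density (bishop_adj r) \<and>
         odd_independence_density (bishop_adj r) \<le> ereal (3 / (4 * real r + 3))"
proof
  show "ereal (1 / (2 * real r + 1)) \<le> odd_independence_density (bishop_adj r)"
    unfolding odd_independence_density_def
    using bishop_pattern_odd_independent upper_density_bishop_pattern_ge
    by (intro SUP_upper2[of "bishop_pattern r"]) auto
  show "odd_independence_density (bishop_adj r) \<le> ereal (3 / (4 * real r + 3))"
    unfolding odd_independence_density_def
    by (intro SUP_least) (simp add: upper_density_odd_independent_set_le)
qed

end
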